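(* Let $q$ be a prime power, let $C\subseteq\mathbb{F}_q^n$ be an $[n,k]$ code over $\mathbb{F}_q$, let $1\le d\le n$, let $f\in\mathrm{Harm}_d(n)$, and let $r\ge 0$ be an integer. Then $$Z_{C,f}^{(r)}(x,y)=(-1)^{d}\sum_{t=d}^{n-d}B_{t,f}^{(r)}(C)\,(x-y)^{t-d}\,y^{n-t-d}.$$
   Context: Let $E=\{1,\dots,n\}$ and let $E_t$ be the set of $t$-element subsets of $E$. $\mathrm{Harm}_d(n)$ is the space of functions $f:E_d\to\mathbb{R}$ such that $\sum_{Z\in E_d,\,Y\subseteq Z}f(Z)=0$ for every $Y\in E_{d-1}$. For $X\subseteq E$ put $\widetilde f(X)=\sum_{Z\in E_d,\,Z\subseteq X}f(Z)$. An $[n,k]$ code over $\mathbb{F}_q$ is a $k$-dimensional linear subspace of $\mathbb{F}_q^n$. For a vector $\mathbf u$, $\mathrm{supp}(\mathbf u)=\{i\in E: u_i\ne 0\}$; for a set $D$ of vectors, $\mathrm{Supp}(D)=\bigcup_{\mathbf u\in D}\mathrm{supp}(\mathbf u)$ and $\mathrm{wt}(D)=|\mathrm{Supp}(D)|$. $\mathcal{D}_r(C)$ is the set of $r$-dimensional linear subspaces of $C$ (empty if $r>\dim C$), and $$A_{i,f}^{(r)}(C)=\sum_{D\in\mathcal{D}_r(C),\ \mathrm{wt}(D)=i}\widetilde f(\mathrm{Supp}(D)).$$ The harmonic $r$-th higher weight enumerator is $W_{C,f}^{(r)}(x,y)=\sum_{i=0}^n A_{i,f}^{(r)}(C)x^{n-i}y^i$;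 it equals $(xy)^dZ_{C,f}^{(r)}(x,y)$, where $$Z_{C,f}^{(r)}(x,y)=\sum_{i=d}^{n-d}A_{i,f}^{(r)}(C)\,x^{n-i-d}y^{i-d}$$ (an empty sum is $0$). For $X\subseteq E$ let $C(X)=\{\mathbf u\in C: u_i=0\text{ for all }i\in X\}$, let $B_X^{(r)}(C)$ be the number of $r$-dimensional linear subspaces of $C(X)$, and for $0\le t\le n$ let $B_{t,f}^{(r)}(C)=\sum_{X\in E_t}\widetilde f(X)B_X^{(r)}(C)$. *)

theory Defs
  imports "HOL-Analysis.Analysis" "HOL-Computational_Algebra.Polynomial"
begin

text \<open>The ground set \<open>E\<close> is an arbitrary finite index type \<open>'n\<close>, with \<open>n = CARD('n)\<close>; vectors of
  length \<open>n\<close> over a finite field \<open>'a\<close> have type \<open>'a ^ 'n\<close>.\<close>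

definition subsets_of_size :: "nat \<Rightarrow> 'n::finite set set" where
  "subsets_of_size t = {X. card X = t}"

text \<open>Functions on the \<open>d\<close>-subsets are total functions on sets; their values on sets of other
  cardinalities are never used. For \<open>d = 0\<close> the index \<open>d - 1\<close> is truncated, so this is meant for
  \<open>d \<ge> 1\<close> only.\<close>

definition Harm :: "nat \<Rightarrow> ('n::finite set \<Rightarrow> real) set" where
  "Harm d = {f. \<forall>Y \<in> subsets_of_size (d - 1).
     (\<Sum>Z \<in> {Z \<in> subsets_of_size d. Y \<subseteq> Z}. f Z) = 0}"

definition harm_tilde :: "nat \<Rightarrow> ('n::finite set \<Rightarrow> real) \<Rightarrow> 'n set \<Rightarrow> real" where
  "harm_tilde d f X = (\<Sum>Z \<in> {Z \<in> subsets_of_size d. Z \<subseteq> X}. f Z)"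

definition linear_code :: "nat \<Rightarrow> ('a::{field,finite} ^ 'n::finite) set \<Rightarrow> bool" where
  "linear_code k C \<longleftrightarrow> vec.subspace C \<and> vec.dim C = k"

definition supp :: "'a::{field,finite} ^ 'n::finite \<Rightarrow> 'n set" where
  "supp u = {i. u $ i \<noteq> 0}"

definition Supp :: "('a::{field,finite} ^ 'n::finite) set \<Rightarrow> 'n set" where
  "Supp D = (\<Union>u\<in>D. supp u)"

definition wt :: "('a::{field,finite} ^ 'n::finite) set \<Rightarrow> nat" where
  "wt D = card (Supp D)"

definition subcodes :: "nat \<Rightarrow> ('a::{field,finite} ^ 'n::finite) set \<Rightarrow> ('a ^ 'n) set set" where
  "subcodes r C = {D. D \<subseteq> C \<and> vec.subspace D \<and> vec.dim D = r}"

definition A_coeff ::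
  "nat \<Rightarrow> ('n::finite set \<Rightarrow> real) \<Rightarrow> nat \<Rightarrow> ('a::{field,finite} ^ 'n) set \<Rightarrow> nat \<Rightarrow> real" where
  "A_coeff d f r C i = (\<Sum>D \<in> {D \<in> subcodes r C. wt D = i}. harm_tilde d f (Supp D))"

text \<open>Bivariate real polynomials are elements of \<open>real poly poly\<close>, that is, of \<open>\<real>[x][y]\<close>; the real
  scalar \<open>a\<close> acts by \<open>smult [:a:]\<close>.\<close>

definition var_x :: "real poly poly" where
  "var_x = [:[:0, 1:]:]"

definition var_y :: "real poly poly" where
  "var_y = [:0, 1:]"

definition Z_poly ::
  "nat \<Rightarrow> ('n::finite set \<Rightarrow> real) \<Rightarrow> nat \<Rightarrow> ('a::{field,finite} ^ 'n) set \<Rightarrow> real poly poly" where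
  "Z_poly d f r C = (\<Sum>i = d..CARD('n) - d.
     smult [:A_coeff d f r C i:] (var_x ^ (CARD('n) - i - d) * var_y ^ (i - d)))"

definition shortened :: "('a::{field,finite} ^ 'n::finite) set \<Rightarrow> 'n set \<Rightarrow> ('a ^ 'n) set" where
  "shortened C X = {u \<in> C. \<forall>i\<in>X. u $ i = 0}"

definition B_set :: "nat \<Rightarrow> ('a::{field,finite} ^ 'n::finite) set \<Rightarrow> 'n set \<Rightarrow> nat" where
  "B_set r C X = card (subcodes r (shortened C X))"

definition B_coeff ::
  "nat \<Rightarrow> ('n::finite set \<Rightarrow> real) \<Rightarrow> nat \<Rightarrow> ('a::{field,finite} ^ 'n) set \<Rightarrow> nat \<Rightarrow> real" where
  "B_coeff d f r C t = (\<Sum>X \<in> subsets_of_size t. harm_tilde d f X * real (B_set r C X))"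

end

theory Submission
  imports Defs
begin

text \<open>
  The proof compares, for a single subspace \<open>D\<close> of dimension \<open>r\<close> with support \<open>S\<close>, its contributions
  to the two sides. On the right, \<open>D\<close> lies in \<open>C(X)\<close> exactly when \<open>X\<close> avoids \<open>S\<close>
  (\<open>subcodes_shortened\<close>), so \<open>D\<close> contributes to \<open>B\<^sub>t\<close> the sum of \<open>harm_tilde d f X\<close> over the
  \<open>t\<close>-subsets \<open>X\<close> of the complement \<open>- S\<close>. Double counting turns this sum into
  \<open>(n - |S| - d choose t - d)\<close> times \<open>harm_tilde d f (- S)\<close> (\<open>sum_harm_tilde_subsets\<close>).

  Harmonicity enters only once, through the duality
  \<open>harm_tilde d f (- S) = (-1) ^ d * harm_tilde d f S\<close> (\<open>harm_tilde_Compl\<close>): expand the condition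
  \<open>Z \<inter> S = {}\<close> by inclusion and exclusion over the subsets \<open>W\<close> of \<open>Z \<inter> S\<close>. A harmonic function sums
  to zero over the \<open>d\<close>-sets above any \<open>W\<close> with fewer than \<open>d\<close> elements, so only \<open>W = Z\<close> survives.

  Collecting the subspaces \<open>D\<close> by weight gives
  \<open>B\<^sub>t = (-1) ^ d * (\<Sum>i. (n - i - d choose t - d) * A\<^sub>i)\<close> (\<open>B_coeff_eq_sum_A_coeff\<close>), where
  \<open>A\<^sub>i\<close> vanishes for \<open>i < d\<close> because a support of size \<open>i\<close> contains no \<open>d\<close>-set, and for \<open>i > n - d\<close>
  because, by the duality, its complement would have to contain one. The claim is then the binomial
  expansion of \<open>x ^ (n - i - d)\<close> with \<open>x = (x - y) + y\<close>.
\<close>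

section \<open>Harmonic functions and complements\<close>

lemma sum_minus_one_power_card_Pow:
  assumes "finite A"
  shows "(\<Sum>W\<in>Pow A. (-1::real) ^ card W) = (if A = {} then 1 else 0)"
proof -
  have "(\<Prod>x\<in>A. (1::real) - 1) = (\<Sum>W\<in>Pow A. (-1) ^ card W * (\<Prod>x\<in>W. 1) * (\<Prod>x\<in>A - W. 1))"
    using assms by (rule prod_diff_conv_sum)
  then show ?thesis using assms by (auto simp: power_0_left)
qed

text \<open>The defining condition concerns only \<open>d - 1\<close> elements. It descends to smaller \<open>W\<close> because each
  \<open>d\<close>-set \<open>Z\<close> above \<open>W\<close> lies above exactly \<open>d - |W|\<close> of the sets \<open>insert a W\<close> with \<open>a \<notin> W\<close>, so the
  sum for \<open>W\<close> is, up to this nonzero factor, a sum of the vanishing sums for \<open>insert a W\<close>.\<close>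

lemma Harm_sum_supersets_eq_0:
  fixes f :: "'n::finite set \<Rightarrow> real"
  assumes f: "f \<in> Harm d" and "card W < d"
  shows "(\<Sum>Z | card Z = d \<and> W \<subseteq> Z. f Z) = 0"
  using \<open>card W < d\<close>
proof (induction "d - card W" arbitrary: W)
  case 0
  then show ?case by simp
next
  case (Suc m)
  show ?case
  proof (cases "card W = d - 1")
    case True
    then show ?thesis using f by (auto simp: Harm_def subsets_of_size_def)
  next
    case False
    have IH: "(\<Sum>Z | card Z = d \<and> insert a W \<subseteq> Z. f Z) = 0" if "a \<notin> W" for a
      using that Suc False by (intro Suc.hyps(1)) auto
    have "real (d - card W) * (\<Sum>Z | card Z = d \<and> W \<subseteq> Z. f Z)
        = (\<Sum>Z | card Z = d \<and> W \<subseteq> Z. \<Sum>a | a \<in> - W \<and> a \<in> Z. f Z)"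
      unfolding sum_distrib_left
    proof (rule sum.cong[OF refl])
      fix Z assume "Z \<in> {Z. card Z = d \<and> W \<subseteq> Z}"
      moreover have "{a. a \<in> - W \<and> a \<in> Z} = Z - W" by auto
      ultimately show "real (d - card W) * f Z = (\<Sum>a | a \<in> - W \<and> a \<in> Z. f Z)"
        by (simp add: card_Diff_subset)
    qed
    also have "\<dots> = (\<Sum>a\<in>- W. \<Sum>Z | Z \<in> {Z. card Z = d \<and> W \<subseteq> Z} \<and> a \<in> Z. f Z)"
      by (rule sum.swap_restrict) auto
    also have "\<dots> = (\<Sum>a\<in>- W. \<Sum>Z | card Z = d \<and> insert a W \<subseteq> Z. f Z)"
      by (intro sum.cong) auto
    also have "\<dots> = 0" using IH by simp
    finally show ?thesis using Suc.prems by simp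
  qed
qed

lemma harm_tilde_Compl:
  fixes f :: "'n::finite set \<Rightarrow> real"
  assumes f: "f \<in> Harm d"
  shows "harm_tilde d f (- S) = (-1) ^ d * harm_tilde d f S"
proof -
  have above: "(\<Sum>Z | card Z = d \<and> W \<subseteq> Z. f Z) = (if card W = d then f W else 0)" for W
  proof (cases "card W < d")
    case True
    then show ?thesis using Harm_sum_supersets_eq_0[OF f] by simp
  next
    case False
    then have "Z = W" if "card Z = d" "W \<subseteq> Z" for Z
      using that card_seteq[of Z W] by simp
    then have "{Z. card Z = d \<and> W \<subseteq> Z} = (if card W = d then {W} else {})"
      by auto
    then show ?thesis by simp
  qed
  have "harm_tilde d f (- S) = (\<Sum>Z | card Z = d. if Z \<inter> S = {} then f Z else 0)"
    unfolding harm_tilde_def subsets_of_size_def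
    by (rule sum.mono_neutral_cong_left) (auto simp: disjoint_eq_subset_Compl split: if_splits)
  also have "\<dots> = (\<Sum>Z | card Z = d. \<Sum>W | W \<in> Pow S \<and> W \<subseteq> Z. (-1) ^ card W * f Z)"
  proof (rule sum.cong[OF refl])
    fix Z :: "'n set"
    have "{W. W \<in> Pow S \<and> W \<subseteq> Z} = Pow (Z \<inter> S)" by auto
    then show "(if Z \<inter> S = {} then f Z else 0) = (\<Sum>W | W \<in> Pow S \<and> W \<subseteq> Z. (-1) ^ card W * f Z)"
      using sum_minus_one_power_card_Pow[of "Z \<inter> S"] by (simp flip: sum_distrib_right)
  qed
  also have "\<dots> = (\<Sum>W\<in>Pow S. \<Sum>Z | Z \<in> {Z. card Z = d} \<and> W \<subseteq> Z. (-1) ^ card W * f Z)"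
    by (rule sum.swap_restrict) auto
  also have "\<dots> = (\<Sum>W\<in>Pow S. (-1) ^ card W * (if card W = d then f W else 0))"
    by (simp add: above flip: sum_distrib_left)
  also have "\<dots> = (\<Sum>W | card W = d \<and> W \<subseteq> S. (-1) ^ d * f W)"
    by (rule sum.mono_neutral_cong_right) auto
  also have "\<dots> = (-1) ^ d * harm_tilde d f S"
    by (simp add: harm_tilde_def subsets_of_size_def sum_distrib_left)
  finally show ?thesis .
qed

lemma harm_tilde_eq_0:
  assumes "card X < d"
  shows "harm_tilde d f X = 0"
proof -
  have "card Z < d" if "Z \<subseteq> X" for Z
    using card_mono[OF _ that] assms by simp
  then have "{Z \<in> subsets_of_size d. Z \<subseteq> X} = {}"
    by (auto simp: subsets_of_size_def)
  then show ?thesis by (simp only: harm_tilde_def sum.empty)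
qed

section \<open>Double counting over the subsets of a set\<close>

lemma card_sets_between:
  assumes "finite T" "Z \<subseteq> T" "card Z \<le> t"
  shows "card {X. card X = t \<and> Z \<subseteq> X \<and> X \<subseteq> T} = (card T - card Z) choose (t - card Z)"
proof -
  have fin: "finite X" if "X \<subseteq> T" for X using that assms(1) by (rule finite_subset)
  have "bij_betw (\<lambda>X. X - Z) {X. card X = t \<and> Z \<subseteq> X \<and> X \<subseteq> T}
      {Y. Y \<subseteq> T - Z \<and> card Y = t - card Z}"
  proof (rule bij_betw_byWitness[where f' = "\<lambda>Y. Y \<union> Z"])
    show "(\<lambda>X. X - Z) ` {X. card X = t \<and> Z \<subseteq> X \<and> X \<subseteq> T}
        \<subseteq> {Y. Y \<subseteq> T - Z \<and> card Y = t - card Z}"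
      using assms fin by (auto simp: card_Diff_subset)
    have "card (Y \<union> Z) = t" if "Y \<subseteq> T - Z" "card Y = t - card Z" for Y
      using that assms fin[of Y] fin[of Z] by (subst card_Un_disjoint) auto
    then show "(\<lambda>Y. Y \<union> Z) ` {Y. Y \<subseteq> T - Z \<and> card Y = t - card Z}
        \<subseteq> {X. card X = t \<and> Z \<subseteq> X \<and> X \<subseteq> T}"
      using assms by auto
  qed auto
  then have "card {X. card X = t \<and> Z \<subseteq> X \<and> X \<subseteq> T} = card {Y. Y \<subseteq> T - Z \<and> card Y = t - card Z}"
    by (rule bij_betw_same_card)
  then show ?thesis using assms fin by (simp add: n_subsets card_Diff_subset)
qed

text \<open>Each \<open>d\<close>-set \<open>Z \<subseteq> T\<close> is counted once for every \<open>t\<close>-set between \<open>Z\<close> and \<open>T\<close>, and the number of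
  these does not depend on \<open>Z\<close>.\<close>

lemma sum_harm_tilde_subsets:
  fixes f :: "'n::finite set \<Rightarrow> real"
  assumes "d \<le> t"
  shows "(\<Sum>X | card X = t \<and> X \<subseteq> T. harm_tilde d f X)
    = real ((card T - d) choose (t - d)) * harm_tilde d f T"
proof -
  have "(\<Sum>X | card X = t \<and> X \<subseteq> T. harm_tilde d f X)
      = (\<Sum>X | card X = t \<and> X \<subseteq> T. \<Sum>Z | Z \<in> {Z. card Z = d \<and> Z \<subseteq> T} \<and> Z \<subseteq> X. f Z)"
    unfolding harm_tilde_def subsets_of_size_def by (intro sum.cong) auto
  also have "\<dots> = (\<Sum>Z | card Z = d \<and> Z \<subseteq> T. \<Sum>X | X \<in> {X. card X = t \<and> X \<subseteq> T} \<and> Z \<subseteq> X. f Z)"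
    by (rule sum.swap_restrict) auto
  also have "\<dots> = (\<Sum>Z | card Z = d \<and> Z \<subseteq> T. real ((card T - d) choose (t - d)) * f Z)"
  proof (rule sum.cong[OF refl])
    fix Z assume "Z \<in> {Z. card Z = d \<and> Z \<subseteq> T}"
    moreover have "{X. X \<in> {X. card X = t \<and> X \<subseteq> T} \<and> Z \<subseteq> X} = {X. card X = t \<and> Z \<subseteq> X \<and> X \<subseteq> T}"
      by auto
    ultimately show "(\<Sum>X | X \<in> {X. card X = t \<and> X \<subseteq> T} \<and> Z \<subseteq> X. f Z)
        = real ((card T - d) choose (t - d)) * f Z"
      using assms card_sets_between[of T Z t] by simp
  qed
  finally show ?thesis
    by (simp add: harm_tilde_def subsets_of_size_def sum_distrib_left)
qed

section \<open>Comparing the coefficients\<close>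

lemma subcodes_shortened:
  "subcodes r (shortened C X) = {D \<in> subcodes r C. X \<subseteq> - Supp D}"
  by (auto simp: subcodes_def shortened_def Supp_def supp_def)

lemma A_coeff_eq_0:
  fixes C :: "('a::{field,finite} ^ 'n::finite) set"
  assumes "f \<in> Harm d" and "i < d \<or> CARD('n) < i + d"
  shows "A_coeff d f r C i = 0"
proof -
  have "harm_tilde d f (Supp D) = 0" if "wt D = i" for D :: "('a ^ 'n) set"
  proof (cases "i < d")
    case True
    then show ?thesis using that by (simp add: wt_def harm_tilde_eq_0)
  next
    case False
    \<comment> \<open>Here \<open>Supp D\<close> has more than \<open>n - d\<close> elements, so its complement contains no \<open>d\<close>-set.\<close>
    then have "card (- Supp D) < d"
      using assms(2) that card_mono[of UNIV "Supp D"]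
      by (auto simp: wt_def Compl_eq_Diff_UNIV card_Diff_subset)
    then show ?thesis
      using harm_tilde_Compl[OF assms(1), of "Supp D"] by (simp add: harm_tilde_eq_0)
  qed
  then show ?thesis by (simp add: A_coeff_def)
qed

lemma B_coeff_eq_sum_A_coeff:
  fixes C :: "('a::{field,finite} ^ 'n::finite) set"
  assumes f: "f \<in> Harm d" and "d \<le> t"
  shows "B_coeff d f r C t
    = (-1) ^ d * (\<Sum>i = d..CARD('n) - d. real ((CARD('n) - i - d) choose (t - d)) * A_coeff d f r C i)"
proof -
  let ?n = "CARD('n)"
  let ?b = "\<lambda>i. real ((?n - i - d) choose (t - d))"
  have "B_coeff d f r C t
      = (\<Sum>X | card X = t. \<Sum>D | D \<in> subcodes r C \<and> X \<subseteq> - Supp D. harm_tilde d f X)"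
    by (simp add: B_coeff_def B_set_def subsets_of_size_def subcodes_shortened mult.commute)
  also have "\<dots> = (\<Sum>D\<in>subcodes r C. \<Sum>X | X \<in> {X. card X = t} \<and> X \<subseteq> - Supp D. harm_tilde d f X)"
    by (rule sum.swap_restrict) auto
  also have "\<dots> = (\<Sum>D\<in>subcodes r C. (-1) ^ d * (?b (wt D) * harm_tilde d f (Supp D)))"
    using sum_harm_tilde_subsets[OF \<open>d \<le> t\<close>, of f] harm_tilde_Compl[OF f]
    by (simp add: wt_def Compl_eq_Diff_UNIV card_Diff_subset mult.left_commute)
  also have "\<dots> = (-1) ^ d * (\<Sum>D\<in>subcodes r C. ?b (wt D) * harm_tilde d f (Supp D))"
    by (simp add: sum_distrib_left)
  also have "(\<Sum>D\<in>subcodes r C. ?b (wt D) * harm_tilde d f (Supp D))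
      = (\<Sum>i\<le>?n. \<Sum>D | D \<in> subcodes r C \<and> wt D = i. ?b (wt D) * harm_tilde d f (Supp D))"
    by (rule sum.group[symmetric]) (auto simp: wt_def card_mono)
  also have "\<dots> = (\<Sum>i\<le>?n. ?b i * A_coeff d f r C i)"
    by (simp add: A_coeff_def sum_distrib_left)
  also have "\<dots> = (\<Sum>i = d..?n - d. ?b i * A_coeff d f r C i)"
    by (rule sum.mono_neutral_right) (auto intro!: A_coeff_eq_0[OF f])
  finally show ?thesis .
qed

text \<open>This is the binomial theorem for \<open>a + b\<close> with exponent \<open>n - i - d\<close>, multiplied by
  \<open>b ^ (i - d)\<close> and with the summation index shifted by \<open>d\<close>. The range of \<open>t\<close> may extend to \<open>n - d\<close>,
  as the binomial coefficient vanishes for \<open>t > n - i\<close>.\<close>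

lemma binomial_shifted:
  fixes a b :: "'b::comm_ring_1"
  assumes "d \<le> i" "i + d \<le> n"
  shows "(\<Sum>t = d..n - d. of_nat ((n - i - d) choose (t - d)) * (a ^ (t - d) * b ^ (n - t - d)))
    = (a + b) ^ (n - i - d) * b ^ (i - d)"
proof -
  let ?m = "n - i - d"
  have "(\<Sum>t = d..n - d. of_nat (?m choose (t - d)) * (a ^ (t - d) * b ^ (n - t - d)))
      = (\<Sum>t = d..n - i. of_nat (?m choose (t - d)) * (a ^ (t - d) * b ^ (n - t - d)))"
    using assms by (intro sum.mono_neutral_right) (auto simp: binomial_eq_0)
  also have "\<dots> = (\<Sum>s\<le>?m. of_nat (?m choose s) * (a ^ s * b ^ (n - (s + d) - d)))"
    using assms by (intro sum.reindex_bij_witness[of _ "\<lambda>s. s + d" "\<lambda>t. t - d"]) auto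
  also have "\<dots> = (\<Sum>s\<le>?m. of_nat (?m choose s) * a ^ s * b ^ (?m - s)) * b ^ (i - d)"
    unfolding sum_distrib_right
  proof (rule sum.cong[OF refl])
    fix s assume "s \<in> {..?m}"
    then have "n - (s + d) - d = (?m - s) + (i - d)" using assms by auto
    then show "of_nat (?m choose s) * (a ^ s * b ^ (n - (s + d) - d))
        = of_nat (?m choose s) * a ^ s * b ^ (?m - s) * b ^ (i - d)"
      by (simp add: power_add mult.assoc)
  qed
  finally show ?thesis by (simp add: binomial_ring)
qed

section \<open>The weight enumerator\<close>

theorem theorem3p2:
  fixes C :: "('a::{field,finite} ^ 'n::finite) set"
    and f :: "'n set \<Rightarrow> real"
    and k d r :: nat
  assumes "linear_code k C"
    and "1 \<le> d" and "d \<le> CARD('n)"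
    and "f \<in> Harm d"
  shows "Z_poly d f r C =
    (-1) ^ d * (\<Sum>t = d..CARD('n) - d.
      smult [:B_coeff d f r C t:] ((var_x - var_y) ^ (t - d) * var_y ^ (CARD('n) - t - d)))"
proof -
  let ?n = "CARD('n)"
  let ?A = "A_coeff d f r C"
  let ?c = "\<lambda>a::real. [:[:a:]:]"
  let ?bin = "\<lambda>i t. (?n - i - d) choose (t - d)"
  let ?P = "\<lambda>t. (var_x - var_y) ^ (t - d) * var_y ^ (?n - t - d)"
  \<comment> \<open>\<open>?c\<close> is the ring embedding of \<open>\<real>\<close> into \<open>\<real>[x][y]\<close>; through it the identity for the real
    coefficients \<open>B\<^sub>t\<close> becomes one between polynomials.\<close>
  have c_sum: "(\<Sum>i\<in>I. ?c (g i)) = ?c (sum g I)" for g and I :: "nat set"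
    by (induction I rule: infinite_finite_induct) auto
  have c_of_nat: "?c (real m) = of_nat m" for m by (simp add: of_nat_poly)
  have c_mult: "?c (a * b) = ?c a * ?c b" for a b by simp
  have c_sign: "?c ((-1) ^ d) = (-1) ^ d" unfolding minus_one_power_iff by (simp add: one_pCons)
  have smult_c: "smult [:a:] p = ?c a * p" for a p by simp
  have B: "(-1) ^ d * ?c (B_coeff d f r C t) = (\<Sum>i = d..?n - d. of_nat (?bin i t) * ?c (?A i))"
    if "d \<le> t" for t
  proof -
    have "(-1) ^ d * B_coeff d f r C t = (\<Sum>i = d..?n - d. real (?bin i t) * ?A i)"
      by (simp add: B_coeff_eq_sum_A_coeff[OF assms(4) that] flip: mult.assoc power_mult_distrib)
    then have "?c ((-1) ^ d) * ?c (B_coeff d f r C t) = ?c (\<Sum>i = d..?n - d. real (?bin i t) * ?A i)"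
      by (simp flip: c_mult)
    then show ?thesis by (simp only: c_sign c_sum[symmetric] c_mult c_of_nat)
  qed
  have "(-1) ^ d * (\<Sum>t = d..?n - d. smult [:B_coeff d f r C t:] (?P t))
      = (\<Sum>t = d..?n - d. (-1) ^ d * ?c (B_coeff d f r C t) * ?P t)"
    by (simp only: smult_c sum_distrib_left mult.assoc)
  also have "\<dots> = (\<Sum>t = d..?n - d. \<Sum>i = d..?n - d. ?c (?A i) * (of_nat (?bin i t) * ?P t))"
    by (intro sum.cong refl) (simp only: B atLeastAtMost_iff sum_distrib_right, simp only: mult_ac)
  also have "\<dots> = (\<Sum>i = d..?n - d. ?c (?A i) * (\<Sum>t = d..?n - d. of_nat (?bin i t) * ?P t))"
    by (subst sum.swap) (simp only: sum_distrib_left)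
  also have "\<dots> = (\<Sum>i = d..?n - d. ?c (?A i) * (var_x ^ (?n - i - d) * var_y ^ (i - d)))"
    using assms(3) by (intro sum.cong refl arg_cong2[where f = "(*)"], subst binomial_shifted) auto
  also have "\<dots> = Z_poly d f r C"
    by (simp only: Z_poly_def smult_c)
  finally show ?thesis by (rule sym)
qed

end
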